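(* Let $P$ be a treetope with base $B$. Then the edges of $P$ not contained in $B$, together with all vertices of $P$, form a tree $T$ (the canopy). The nonempty faces of $P$ are partitioned into the following three classes: (1) the nonempty faces of $B$; (2) the vertices and edges of $P$ that are disjoint from $B$; (3) for each nonempty face $F$ of $B$ of dimension $i$, exactly one face $F'$ of $P$ of dimension $i+1$ with $F'\ne F$ and $F'\cap B=F$ (the lift of $F$). Moreover, for each face $F$ of $B$ with $\dim F\ge 1$, its lift $F'$ is a treetope with base $F$, and the canopy of $F'$ is the minimal subtree of $T$ containing all vertices of $F$.
   Context: A polytope is the convex hull of a finite set of points in a Euclidean space; faces, vertices, edges, facets and the graph (1-skeleton) are as usual. A \emph{treetope} is a polytope $P$ together with a distinguished facet $B$ (the \emph{base}) such that every face $F$ of $P$ whose intersection $F\cap B$ consists of at most one point has dimension at most one. The \emph{canopy} of a treetope $P$ with base $B$ is the graph whose vertices are the vertices of $P$ and whose edges are the edges of $P$ not contained in $B$. *)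

theory Defs
  imports "HOL-Analysis.Analysis"
begin

section \<open>Finite simple graphs given by a vertex set and a set of 2-element edges\<close>

definition simple_graph :: "'a set \<Rightarrow> 'a set set \<Rightarrow> bool" where
  "simple_graph V Ed \<longleftrightarrow> finite V \<and>
     (\<forall>e\<in>Ed. \<exists>u v. e = {u, v} \<and> u \<noteq> v \<and> u \<in> V \<and> v \<in> V)"

definition graph_adj :: "'a set set \<Rightarrow> ('a \<times> 'a) set" where
  "graph_adj Ed = {(x, y). {x, y} \<in> Ed \<and> x \<noteq> y}"

definition graph_connected :: "'a set \<Rightarrow> 'a set set \<Rightarrow> bool" where
  "graph_connected V Ed \<longleftrightarrow> V \<noteq> {} \<and> (\<forall>u\<in>V. \<forall>v\<in>V. (u, v) \<in> (graph_adj Ed)\<^sup>*)"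

text \<open>A cycle: at least three distinct vertices, cyclically consecutive ones adjacent.\<close>
definition graph_has_cycle :: "'a set \<Rightarrow> 'a set set \<Rightarrow> bool" where
  "graph_has_cycle V Ed \<longleftrightarrow> (\<exists>cs. length cs \<ge> 3 \<and> distinct cs \<and> set cs \<subseteq> V \<and>
      (\<forall>i < length cs. {cs ! i, cs ! ((i + 1) mod length cs)} \<in> Ed))"

text \<open>A tree: a (finite, nonempty) connected acyclic graph.\<close>
definition is_tree :: "'a set \<Rightarrow> 'a set set \<Rightarrow> bool" where
  "is_tree V Ed \<longleftrightarrow> simple_graph V Ed \<and> graph_connected V Ed \<and> \<not> graph_has_cycle V Ed"

definition is_subtree :: "'a set \<Rightarrow> 'a set set \<Rightarrow> 'a set \<Rightarrow> 'a set set \<Rightarrow> bool" where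
  "is_subtree V Ed V' Ed' \<longleftrightarrow> V' \<subseteq> V \<and> Ed' \<subseteq> Ed \<and> is_tree V' Ed'"

text \<open>(V', Ed') is the minimal subtree of (V, Ed) containing the vertex set S.\<close>
definition is_minimal_subtree_containing ::
  "'a set \<Rightarrow> 'a set set \<Rightarrow> 'a set \<Rightarrow> 'a set \<Rightarrow> 'a set set \<Rightarrow> bool" where
  "is_minimal_subtree_containing V Ed S V' Ed' \<longleftrightarrow>
     is_subtree V Ed V' Ed' \<and> S \<subseteq> V' \<and>
     (\<forall>V'' Ed''. is_subtree V Ed V'' Ed'' \<and> S \<subseteq> V'' \<longrightarrow> V' \<subseteq> V'' \<and> Ed' \<subseteq> Ed'')"

section \<open>Treetopes\<close>

text \<open>Vertices of a polytope: its extreme points (= 0-dimensional faces).\<close>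
definition vertices :: "'a::euclidean_space set \<Rightarrow> 'a set" where
  "vertices P = {v. v extreme_point_of P}"

definition treetope :: "'a::euclidean_space set \<Rightarrow> 'a set \<Rightarrow> bool" where
  "treetope P B \<longleftrightarrow> polytope P \<and> B facet_of P \<and>
     (\<forall>F. F face_of P \<and> (F \<inter> B = {} \<or> (\<exists>x. F \<inter> B = {x})) \<longrightarrow> aff_dim F \<le> 1)"

text \<open>Canopy: vertices of P, and the edges of P not contained in B, each edge
  represented by the set of its two endpoints.\<close>
definition canopy_vertices :: "'a::euclidean_space set \<Rightarrow> 'a set" where
  "canopy_vertices P = vertices P"

definition canopy_edges :: "'a::euclidean_space set \<Rightarrow> 'a set \<Rightarrow> 'a set set" where
  "canopy_edges P B = {vertices E | E. E edge_of P \<and> \<not> E \<subseteq> B}"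

text \<open>Lift of a face F of the base B.\<close>
definition is_lift :: "'a::euclidean_space set \<Rightarrow> 'a set \<Rightarrow> 'a set \<Rightarrow> 'a set \<Rightarrow> bool" where
  "is_lift P B F F' \<longleftrightarrow> F' face_of P \<and> aff_dim F' = aff_dim F + 1 \<and> F' \<noteq> F \<and> F' \<inter> B = F"

definition lift :: "'a::euclidean_space set \<Rightarrow> 'a set \<Rightarrow> 'a set \<Rightarrow> 'a set" where
  "lift P B F = (THE F'. is_lift P B F F')"

end

theory Submission
  imports Defs
begin

text \<open>Everything rests on tilting supporting hyperplanes. Let \<open>c\<close> be a linear functional that is constant
  on a face \<open>F\<close>. If some point of \<open>P\<close> lies above \<open>F\<close>, then \<open>F\<close> lies in a larger face that is otherwise
  strictly above \<open>F\<close>; and two different such upward faces meeting in \<open>F\<close> force an upward face of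
  dimension at least \<open>dim F + 2\<close>. In a treetope a face that meets \<open>B\<close> in \<open>G \<noteq> {}\<close> has dimension at most
  \<open>dim G + 1\<close>, so with \<open>c\<close> the height above the base every face of \<open>B\<close> has exactly one lift. Likewise
  every vertex that is not highest has an ascending edge (connectedness of the canopy), while two
  edges ascending from a vertex above the base would span a face of dimension at least 2 that misses
  \<open>B\<close> (acyclicity). Vertices of a lift outside \<open>F\<close> have degree at least 2 in its canopy, so its leaves
  lie in \<open>F\<close>, which gives minimality.\<close>

section \<open>Trees\<close>

lemma simple_graph_edgeD:
  assumes "simple_graph V Ed" "{x, y} \<in> Ed"
  shows "x \<in> V" "y \<in> V" "x \<noteq> y"
proof -
  obtain a b where "{x, y} = {a, b}" "a \<noteq> b" "a \<in> V" "b \<in> V"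
    using assms unfolding simple_graph_def by blast
  then show "x \<in> V" "y \<in> V" "x \<noteq> y" by (auto simp: doubleton_eq_iff)
qed

lemma graph_adj_mono: "A \<subseteq> B \<Longrightarrow> graph_adj A \<subseteq> graph_adj B"
  by (auto simp: graph_adj_def)

lemma graph_adj_rtrancl_mono:
  "A \<subseteq> B \<Longrightarrow> (u, v) \<in> (graph_adj A)\<^sup>* \<Longrightarrow> (u, v) \<in> (graph_adj B)\<^sup>*"
  using rtrancl_mono[OF graph_adj_mono] by blast

lemma graph_adj_rtrancl_sym:
  "(u, v) \<in> (graph_adj A)\<^sup>* \<Longrightarrow> (v, u) \<in> (graph_adj A)\<^sup>*"
proof -
  have "sym (graph_adj A)"
    by (auto simp: sym_def graph_adj_def insert_commute)
  then show "(u, v) \<in> (graph_adj A)\<^sup>* \<Longrightarrow> (v, u) \<in> (graph_adj A)\<^sup>*"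
    by (meson sym_rtrancl symD)
qed

lemma rtrancl_imp_distinct_walk:
  assumes "(u, v) \<in> (graph_adj Ed)\<^sup>*"
  shows "\<exists>p. p \<noteq> [] \<and> hd p = u \<and> last p = v \<and> distinct p
    \<and> successively (\<lambda>x y. {x, y} \<in> Ed) p"
  using assms
proof (induction rule: converse_rtrancl_induct)
  case base
  show ?case by (rule exI[of _ "[v]"]) simp
next
  case (step x y)
  then obtain p where p: "p \<noteq> []" "hd p = y" "last p = v" "distinct p"
    "successively (\<lambda>x y. {x, y} \<in> Ed) p" by blast
  show ?case
  proof (cases "x \<in> set p")
    case True
    \<comment> \<open>The walk returns to \<open>x\<close>, so the loop is cut off by keeping only
      the part from that occurrence of \<open>x\<close> on.\<close>
    then obtain ps qs where "p = ps @ x # qs" by (meson split_list)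
    with p show ?thesis
      by (intro exI[of _ "x # qs"]) (auto simp: successively_append_iff)
  next
    case False
    with p step.hyps(1) show ?thesis
      by (intro exI[of _ "x # p"]) (auto simp: successively_Cons graph_adj_def)
  qed
qed

text \<open>Hides the modular indexing of \<open>graph_has_cycle\<close>: only the last index wraps
  around, and it gives the closing edge.\<close>

lemma closed_walk_cycle:
  assumes "3 \<le> length p" "distinct p" "set p \<subseteq> V"
    "successively (\<lambda>x y. {x, y} \<in> Ed) p" "{last p, hd p} \<in> Ed"
  shows "graph_has_cycle V Ed"
proof -
  have "{p ! i, p ! ((i + 1) mod length p)} \<in> Ed" if i: "i < length p" for i
  proof (cases "i + 1 < length p")
    case True
    then show ?thesis
      using assms(4) by (simp add: successively_conv_nth)
  next
    case False
    with i have "i + 1 = length p" by simp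
    moreover have "p \<noteq> []" using assms(1) by auto
    then have "p ! i = last p" "p ! 0 = hd p"
      using \<open>i + 1 = length p\<close> by (simp_all add: last_conv_nth hd_conv_nth flip: \<open>i + 1 = length p\<close>)
    ultimately show ?thesis using assms(5) by simp
  qed
  then show ?thesis
    using assms unfolding graph_has_cycle_def by blast
qed

lemma cycle_two_neighbours:
  assumes "length cs \<ge> 3" "distinct cs"
    "\<forall>i < length cs. {cs ! i, cs ! ((i + 1) mod length cs)} \<in> Ed" "w \<in> set cs"
  obtains u1 u2 where "u1 \<in> set cs" "u2 \<in> set cs" "u1 \<noteq> u2" "u1 \<noteq> w" "u2 \<noteq> w"
    "{w, u1} \<in> Ed" "{w, u2} \<in> Ed"
proof -
  let ?n = "length cs"
  obtain i where i: "i < ?n" "w = cs ! i" using assms(4) by (metis in_set_conv_nth)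
  let ?j = "(i + 1) mod ?n"
  \<comment> \<open>The cyclic predecessor of \<open>i\<close>; it differs from the successor
    because the cycle has length at least 3.\<close>
  define k where "k = (if i = 0 then ?n - 1 else i - 1)"
  have k: "k < ?n" "(k + 1) mod ?n = i" using i assms(1) by (auto simp: k_def)
  have j: "?j < ?n" using assms(1) by (intro mod_less_divisor) linarith
  have ne: "?j \<noteq> k" "?j \<noteq> i" "k \<noteq> i"
    using i assms(1) by (auto simp: k_def mod_if split: if_splits)
  have "{w, cs ! ?j} \<in> Ed" using assms(3) i by blast
  moreover have "{w, cs ! k} \<in> Ed"
  proof -
    have "{cs ! k, cs ! ((k + 1) mod ?n)} \<in> Ed" using assms(3) k(1) by blast
    then show ?thesis using k(2) i(2) by (simp add: insert_commute)
  qed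
  ultimately show ?thesis
    using that[of "cs ! ?j" "cs ! k"] ne i j k(1) assms(2) by (simp add: nth_eq_iff_index_eq)
qed

text \<open>A simple walk from \<open>u\<close> to \<open>v\<close> around the edge would close up
  with it to a cycle.\<close>

lemma acyclic_edge_is_bridge:
  assumes "simple_graph V Ed" "\<not> graph_has_cycle V Ed" "{u, v} \<in> Ed" "u \<noteq> v"
  shows "(u, v) \<notin> (graph_adj (Ed - {{u, v}}))\<^sup>*"
proof
  assume walk_uv: "(u, v) \<in> (graph_adj (Ed - {{u, v}}))\<^sup>*"
  obtain p where p: "p \<noteq> []" "hd p = u" "last p = v" "distinct p"
    "successively (\<lambda>x y. {x, y} \<in> Ed - {{u, v}}) p"
    using rtrancl_imp_distinct_walk[OF walk_uv] by (elim exE conjE)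
  obtain y q where pq: "p = u # y # q"
    using p(1-3) assms(4) by (cases p rule: remdups_adj.cases) auto
  \<comment> \<open>The first step is not the deleted edge, so the walk has an interior vertex and
    hence the length that a cycle requires.\<close>
  have "{u, y} \<noteq> {u, v}" using p(5) by (simp add: pq successively_Cons)
  then have "q \<noteq> []" using p(3) by (auto simp: pq)
  then have "length p \<ge> 3" using pq by (cases q) auto
  moreover have walk: "successively (\<lambda>x y. {x, y} \<in> Ed) p"
    using p(5) by (rule successively_mono) auto
  moreover have "set p \<subseteq> V"
  proof -
    note V = simple_graph_edgeD[OF assms(1)]
    have "u \<in> V" using V(1)[OF assms(3)] .
    have "set p \<subseteq> V" if "successively (\<lambda>x y. {x, y} \<in> Ed) p" "p \<noteq> []" "hd p \<in> V" for p
      using that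
    proof (induction p)
      case (Cons a p)
      then show ?case using V(2)[of a "hd p"] by (cases p) auto
    qed simp
    then show ?thesis using walk p(1,2) \<open>u \<in> V\<close> by blast
  qed
  ultimately show False
    using closed_walk_cycle[of p V Ed] p(2-4) assms(2,3) by (simp add: insert_commute)
qed

text \<open>A walk that never backtracks can only stop in \<open>S\<close>; acyclicity keeps it simple, so it
  avoids every edge \<open>e\<close> at a vertex \<open>u\<close> that it has already left.\<close>
lemma simple_walk_reaches:
  assumes G: "simple_graph V Ed" and acyc: "\<not> graph_has_cycle V Ed"
    and deg: "\<And>x y. x \<in> V \<Longrightarrow> x \<notin> S \<Longrightarrow> \<exists>z. z \<noteq> y \<and> {x, z} \<in> Ed"
    and "u \<in> e"
  shows "distinct (x # y # q) \<Longrightarrow> successively (\<lambda>x y. {x, y} \<in> Ed) (x # y # q)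
    \<Longrightarrow> set (x # y # q) \<subseteq> V \<Longrightarrow> u \<in> set (y # q)
    \<Longrightarrow> \<exists>s\<in>S. (x, s) \<in> (graph_adj (Ed - {e}))\<^sup>*"
\<comment> \<open>The list is the walk in reverse: \<open>x\<close> is the current vertex and
  \<open>y\<close> the previous one. The measure counts unvisited vertices.\<close>
proof (induction "card V - length (x # y # q)" arbitrary: x y q rule: less_induct)
  case less
  show ?case
  proof (cases "x \<in> S")
    case False
    then obtain z where z: "z \<noteq> y" "{x, z} \<in> Ed"
      using deg[of x y] less.prems(3) by auto
    then have zx: "z \<noteq> x" and zV: "z \<in> V"
      using simple_graph_edgeD[OF G] by blast+
    \<comment> \<open>A repeated vertex \<open>z\<close> would lie beyond \<open>y\<close> in the
      list, so the stretch from \<open>x\<close> to \<open>z\<close> has at least three vertices and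
      is closed by the edge \<open>{x, z}\<close>.\<close>
    have new: "z \<notin> set (x # y # q)"
    proof
      assume "z \<in> set (x # y # q)"
      then obtain q1 q2 where q: "q = q1 @ z # q2" using z zx by (auto dest: split_list)
      have "x # y # q = (x # y # q1 @ [z]) @ q2" using q by simp
      then have "distinct (x # y # q1 @ [z])" "set (x # y # q1 @ [z]) \<subseteq> V"
        "successively (\<lambda>x y. {x, y} \<in> Ed) (x # y # q1 @ [z])"
        using less.prems(1-3) by (auto simp: successively_append_iff successively_Cons simp del: append.simps)
      then show False
        using closed_walk_cycle[of "x # y # q1 @ [z]" V Ed] acyc z(2)
        by (simp add: insert_commute)
    qed
    \<comment> \<open>Natural subtraction truncates at 0, so the measure drops only because the
      extended walk still fits into \<open>V\<close>.\<close>
    have "length (z # x # y # q) \<le> card V"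
      using new less.prems(1,3) zV G
        card_mono[of V "set (z # x # y # q)"] distinct_card[of "z # x # y # q"]
      unfolding simple_graph_def by auto
    then have "\<exists>s\<in>S. (z, s) \<in> (graph_adj (Ed - {e}))\<^sup>*"
      using less.prems new z zV by (intro less.hyps[of z x "y # q"]) (auto simp: insert_commute)
    moreover have "{x, z} \<noteq> e"
      using \<open>u \<in> e\<close> less.prems(1,4) new by auto
    then have "(x, z) \<in> graph_adj (Ed - {e})"
      using z zx by (simp add: graph_adj_def)
    ultimately show ?thesis by (meson converse_rtrancl_into_rtrancl)
  qed blast
qed

text \<open>From both ends of an edge in \<open>E'\<close> one reaches \<open>S\<close> without
  using that edge. A subtree that contains \<open>S\<close> but omits the edge would join the two
  vertices reached, giving a way around a bridge of the tree.\<close>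

lemma minimal_subtreeI:
  assumes T: "is_tree V Ed" and sub: "is_subtree V Ed V' E'" and "S \<subseteq> V'"
    and ne: "a \<in> V'" "b \<in> V'" "a \<noteq> b"
    and deg: "\<And>x y. x \<in> V' \<Longrightarrow> x \<notin> S \<Longrightarrow> \<exists>z. z \<noteq> y \<and> {x, z} \<in> E'"
  shows "is_minimal_subtree_containing V Ed S V' E'"
proof -
  have T': "is_tree V' E'" and "E' \<subseteq> Ed" using sub by (auto simp: is_subtree_def)
  then have G': "simple_graph V' E'" and A': "\<not> graph_has_cycle V' E'"
    and C': "graph_connected V' E'" by (auto simp: is_tree_def)
  have reach: "\<exists>s\<in>S. (x, s) \<in> (graph_adj (Ed - {{x, y}}))\<^sup>*"
    if e: "{x, y} \<in> E'" "x \<noteq> y" for x y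
  proof -
    have "x \<in> V'" "y \<in> V'" using simple_graph_edgeD[OF G' e(1)] by auto
    \<comment> \<open>The walk starts as if it had just come from \<open>y\<close> to
      \<open>x\<close>, so \<open>y\<close> is the vertex already left.\<close>
    then have "\<exists>s\<in>S. (x, s) \<in> (graph_adj (E' - {{x, y}}))\<^sup>*"
      using simple_walk_reaches[OF G' A' deg, of S y "{x, y}" x y "[]"] e by auto
    then show ?thesis
      using graph_adj_rtrancl_mono[of "E' - {{x, y}}" "Ed - {{x, y}}"] \<open>E' \<subseteq> Ed\<close> by blast
  qed
  have "V' \<subseteq> V'' \<and> E' \<subseteq> E''" if sub'': "is_subtree V Ed V'' E''" and "S \<subseteq> V''" for V'' E''
  proof -
    have "E'' \<subseteq> Ed" and G'': "simple_graph V'' E''" and C'': "graph_connected V'' E''"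
      using sub'' by (auto simp: is_subtree_def is_tree_def)
    have E: "E' \<subseteq> E''"
    proof
      fix e assume "e \<in> E'"
      then obtain x y where e: "e = {x, y}" "x \<noteq> y" using G' unfolding simple_graph_def by blast
      show "e \<in> E''"
      proof (rule ccontr)
        assume "e \<notin> E''"
        then have inc: "E'' \<subseteq> Ed - {{x, y}}" using e \<open>E'' \<subseteq> Ed\<close> by blast
        obtain s where s: "s \<in> S" "(x, s) \<in> (graph_adj (Ed - {{x, y}}))\<^sup>*"
          using reach e \<open>e \<in> E'\<close> by blast
        obtain t where t: "t \<in> S" "(y, t) \<in> (graph_adj (Ed - {{x, y}}))\<^sup>*"
          using reach[of y x] e \<open>e \<in> E'\<close> by (metis insert_commute)
        have "(s, t) \<in> (graph_adj E'')\<^sup>*"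
          using C'' s t \<open>S \<subseteq> V''\<close> unfolding graph_connected_def by blast
        then have "(s, t) \<in> (graph_adj (Ed - {{x, y}}))\<^sup>*"
          using graph_adj_rtrancl_mono[OF inc] by blast
        then have "(x, y) \<in> (graph_adj (Ed - {{x, y}}))\<^sup>*"
          using s t graph_adj_rtrancl_sym by (meson rtrancl_trans)
        then show False
          using acyclic_edge_is_bridge[of V Ed x y] T e \<open>e \<in> E'\<close> \<open>E' \<subseteq> Ed\<close>
          unfolding is_tree_def by blast
      qed
    qed
    \<comment> \<open>Since \<open>V'\<close> has two distinct vertices and is connected, each of
      its vertices lies on an edge of \<open>E'\<close>; inclusion of edges thus yields inclusion of
      vertices.\<close>
    have "x \<in> V''" if "x \<in> V'" for x
    proof -
      obtain y where "y \<in> V'" "y \<noteq> x" using ne by blast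
      then have "(x, y) \<in> (graph_adj E')\<^sup>*"
        using C' that unfolding graph_connected_def by blast
      then obtain z where "(x, z) \<in> graph_adj E'"
        using \<open>y \<noteq> x\<close> by (auto elim: converse_rtranclE)
      then have "{x, z} \<in> E''" using E by (auto simp: graph_adj_def)
      then show ?thesis using simple_graph_edgeD(1)[OF G''] by blast
    qed
    with E show ?thesis by blast
  qed
  then show ?thesis
    using sub \<open>S \<subseteq> V'\<close> unfolding is_minimal_subtree_containing_def by blast
qed

section \<open>Faces of polytopes\<close>

lemma mem_vertices_face:
  "F face_of P \<Longrightarrow> v \<in> vertices F \<longleftrightarrow> v \<in> vertices P \<and> v \<in> F"
  by (simp add: vertices_def extreme_point_of_face)

lemma vertices_subset: "vertices P \<subseteq> P"
  by (auto simp: vertices_def extreme_point_of_def)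

lemma singleton_face_of_vertex: "{v} face_of P \<longleftrightarrow> v \<in> vertices P"
  by (simp add: vertices_def face_of_singleton)

lemma finite_vertices: "polytope P \<Longrightarrow> finite (vertices P)"
  unfolding vertices_def
  by (simp add: finite_polyhedron_extreme_points polytope_imp_polyhedron)

lemma polytope_eq_hull_vertices:
  fixes P :: "'a::euclidean_space set"
  assumes "polytope P" shows "P = convex hull vertices P"
  unfolding vertices_def
  using assms by (intro Krein_Milman_Minkowski polytope_imp_compact polytope_imp_convex)

lemma inner_le_if_vertices:
  fixes P :: "'a::euclidean_space set"
  assumes "polytope P" "\<And>v. v \<in> vertices P \<Longrightarrow> h \<bullet> v \<le> b" "x \<in> P"
  shows "h \<bullet> x \<le> b"
proof -
  have "convex hull vertices P \<subseteq> {x. h \<bullet> x \<le> b}"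
    using assms(2) by (intro hull_minimal) (auto simp: convex_halfspace_le)
  then show ?thesis using polytope_eq_hull_vertices[OF assms(1)] assms(3) by blast
qed

lemma exists_vertex_gt:
  fixes P :: "'a::euclidean_space set"
  assumes "polytope P" "x \<in> P" "b < h \<bullet> x"
  obtains v where "v \<in> vertices P" "b < h \<bullet> v"
  using inner_le_if_vertices[OF assms(1) _ assms(2)] assms(3) by (meson not_le)

lemma exists_vertex:
  fixes P :: "'a::euclidean_space set"
  assumes "polytope P" "P \<noteq> {}"
  obtains v where "v \<in> vertices P"
  using polytope_eq_hull_vertices[OF assms(1)] assms(2) by (metis convex_hull_empty ex_in_conv)

lemma face_obtain_functional:
  fixes P :: "'a::euclidean_space set"
  assumes "polytope P" "F face_of P"
  obtains h b where "\<And>x. x \<in> P \<Longrightarrow> h \<bullet> x \<le> b" "\<And>x. x \<in> F \<longleftrightarrow> x \<in> P \<and> h \<bullet> x = b"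
proof -
  have "F exposed_face_of P"
    using assms exposed_face_of_polyhedron polytope_imp_polyhedron by blast
  then obtain h b where "P \<subseteq> {x. h \<bullet> x \<le> b}" "F = P \<inter> {x. h \<bullet> x = b}"
    unfolding exposed_face_of_def by blast
  then show ?thesis using that[of h b] by blast
qed

lemma face_of_vertex_functional:
  fixes P :: "'a::euclidean_space set"
  assumes "polytope P" "\<And>v. v \<in> vertices P \<Longrightarrow> h \<bullet> v \<le> b"
  shows "(P \<inter> {x. h \<bullet> x = b}) face_of P"
  using assms inner_le_if_vertices
  by (intro face_of_Int_supporting_hyperplane_le polytope_imp_convex) blast+

section \<open>Tilting supporting hyperplanes\<close>

text \<open>The hyperplane exposing \<open>F\<close> is rotated about \<open>F\<close> in the
  direction of \<open>c\<close> until it first hits a vertex above level \<open>d\<close>.\<close>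

lemma tilt_face:
  fixes P :: "'a::euclidean_space set"
  assumes P: "polytope P" and F: "F face_of P"
    and zero: "\<And>x. x \<in> F \<Longrightarrow> c \<bullet> x = d" and w0: "w0 \<in> P" "d < c \<bullet> w0"
  obtains Q where "Q face_of P" "F \<subseteq> Q" "Q \<noteq> F"
    "\<And>x. x \<in> Q \<Longrightarrow> x \<notin> F \<Longrightarrow> d < c \<bullet> x"
proof -
  obtain h b where hb: "\<And>x. x \<in> P \<Longrightarrow> h \<bullet> x \<le> b" "\<And>x. x \<in> F \<longleftrightarrow> x \<in> P \<and> h \<bullet> x = b"
    using face_obtain_functional[OF P F] by blast
  define W where "W = {w \<in> vertices P. d < c \<bullet> w}"
  \<comment> \<open>The amount of tilt at which \<open>w\<close> reaches the hyperplane: its slack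
    divided by its height. The minimum \<open>t\<close> is the first contact, so no vertex has
    crossed over.\<close>
  define q where "q w = (b - h \<bullet> w) / (c \<bullet> w - d)" for w
  define t where "t = Min (q ` W)"
  have finW: "finite W" using finite_vertices[OF P] by (simp add: W_def)
  obtain w1 where "w1 \<in> vertices P" "d < c \<bullet> w1" using exists_vertex_gt[OF P w0] by blast
  then have "W \<noteq> {}" by (auto simp: W_def)
  then obtain w where w: "w \<in> W" "t = q w"
    using Min_in[of "q ` W"] finW unfolding t_def by blast
  have WP: "x \<in> P" if "x \<in> W" for x using that vertices_subset by (auto simp: W_def)
  have WF: "x \<notin> F" if "x \<in> W" for x using that zero by (force simp: W_def)
  have q: "h \<bullet> x - b = - q x * (c \<bullet> x - d)" if "x \<in> W" for x
    using that by (simp add: q_def W_def)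
  have "0 < t"
    using hb WP[OF w(1)] WF[OF w(1)] w
    by (auto simp: q_def W_def intro!: divide_pos_pos order.not_eq_order_implies_strict)
  have ex: "(h + t *\<^sub>R c) \<bullet> x - (b + t * d) = (h \<bullet> x - b) + t * (c \<bullet> x - d)" for x
    by (simp add: inner_add_left algebra_simps)
  define Q where "Q = P \<inter> {x. (h + t *\<^sub>R c) \<bullet> x = b + t * d}"
  have Q: "x \<in> Q \<longleftrightarrow> x \<in> P \<and> (h \<bullet> x - b) + t * (c \<bullet> x - d) = 0" for x
    using ex[of x] by (auto simp: Q_def)
  have "Q face_of P"
    unfolding Q_def
  proof (rule face_of_vertex_functional[OF P])
    fix v assume v: "v \<in> vertices P"
    have "(h \<bullet> v - b) + t * (c \<bullet> v - d) \<le> 0"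
    proof (cases "v \<in> W")
      case True
      then have "t \<le> q v" using finW by (simp add: t_def)
      then show ?thesis using q[OF True] True
        by (simp add: W_def mult_right_mono)
    next
      case False
      then have "t * (c \<bullet> v - d) \<le> 0" using v \<open>0 < t\<close> by (simp add: W_def mult_nonneg_nonpos)
      then show ?thesis using hb(1)[of v] v vertices_subset by fastforce
    qed
    then show "(h + t *\<^sub>R c) \<bullet> v \<le> b + t * d" using ex[of v] by linarith
  qed
  moreover have "F \<subseteq> Q" using hb(2) zero by (auto simp: Q)
  moreover have "w \<in> Q" using q[OF w(1)] w WP by (simp add: Q)
  then have "Q \<noteq> F" using WF w(1) by blast
  \<comment> \<open>Off \<open>F\<close> the functional \<open>h\<close> has strict slack, which on
    \<open>Q\<close> only a positive height can compensate.\<close>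
  moreover have "d < c \<bullet> x" if "x \<in> Q" "x \<notin> F" for x
  proof -
    have "h \<bullet> x - b < 0" using hb that by (force simp: Q)
    then have "0 < t * (c \<bullet> x - d)" using that by (simp add: Q)
    then show ?thesis using \<open>0 < t\<close> by (simp add: zero_less_mult_iff)
  qed
  ultimately show ?thesis using that by blast
qed

text \<open>The functional exposing the new face is \<open>h2 + r h1 + \<beta> c\<close>, where \<open>h1\<close>, \<open>h2\<close> expose the given
  faces: \<open>\<beta>\<close> is the largest tilt of \<open>h2\<close> that keeps \<open>L1\<close> on the correct side, and \<open>r\<close> is then the
  smallest multiple of \<open>h1\<close> that corrects the remaining vertices.\<close>
lemma two_upward_faces_span:
  fixes P :: "'a::euclidean_space set"
  assumes P: "polytope P" and L1: "L1 face_of P" and L2: "L2 face_of P"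
    and ne: "L1 \<noteq> L1 \<inter> L2" "L2 \<noteq> L1 \<inter> L2"
    and zero: "\<And>x. x \<in> L1 \<inter> L2 \<Longrightarrow> c \<bullet> x = d"
    and pos: "\<And>x. x \<in> L1 \<union> L2 \<Longrightarrow> x \<notin> L1 \<inter> L2 \<Longrightarrow> d < c \<bullet> x"
  obtains Q where "Q face_of P" "L1 \<inter> L2 \<subseteq> Q"
    "\<And>x. x \<in> Q \<Longrightarrow> x \<notin> L1 \<inter> L2 \<Longrightarrow> d < c \<bullet> x"
    "aff_dim (L1 \<inter> L2) + 2 \<le> aff_dim Q"
proof -
  let ?F = "L1 \<inter> L2"
  obtain h1 b1 where h1: "\<And>x. x \<in> P \<Longrightarrow> h1 \<bullet> x \<le> b1" "\<And>x. x \<in> L1 \<longleftrightarrow> x \<in> P \<and> h1 \<bullet> x = b1"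
    using face_obtain_functional[OF P L1] by blast
  obtain h2 b2 where h2: "\<And>x. x \<in> P \<Longrightarrow> h2 \<bullet> x \<le> b2" "\<And>x. x \<in> L2 \<longleftrightarrow> x \<in> P \<and> h2 \<bullet> x = b2"
    using face_obtain_functional[OF P L2] by blast
  define W where "W = {w \<in> vertices P. d < c \<bullet> w}"
  define p where "p w = (b1 - h1 \<bullet> w) / (c \<bullet> w - d)" for w
  define q where "q w = (b2 - h2 \<bullet> w) / (c \<bullet> w - d)" for w
  have finW: "finite W" using finite_vertices[OF P] by (simp add: W_def)
  have WP: "x \<in> P" if "x \<in> W" for x using that vertices_subset by (auto simp: W_def)
  have WF: "x \<notin> ?F" if "x \<in> W" for x using that zero by (force simp: W_def)
  have W_pos: "0 < c \<bullet> x - d" if "x \<in> W" for x using that by (simp add: W_def)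
  have pW: "h1 \<bullet> x - b1 = - p x * (c \<bullet> x - d)" if "x \<in> W" for x
    using that by (simp add: p_def W_def)
  have qW: "h2 \<bullet> x - b2 = - q x * (c \<bullet> x - d)" if "x \<in> W" for x
    using that by (simp add: q_def W_def)
  have p_pos: "0 < p x" if "x \<in> W" "x \<notin> L1" for x
    using h1 WP[OF that(1)] that W_pos[OF that(1)] unfolding p_def
    by (intro divide_pos_pos) (auto simp: less_le)
  have q_pos: "0 < q x" if "x \<in> W" "x \<notin> L2" for x
    using h2 WP[OF that(1)] that W_pos[OF that(1)] unfolding q_def
    by (intro divide_pos_pos) (auto simp: less_le)
  have has_W: "\<exists>w \<in> W. w \<in> L" if L: "L face_of P" "x \<in> L" "d < c \<bullet> x" for L x
  proof -
    obtain v where "v \<in> vertices L" "d < c \<bullet> v"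
      using exists_vertex_gt[OF face_of_polytope_polytope[OF P L(1)] L(2,3)] by blast
    then show ?thesis using mem_vertices_face[OF L(1)] by (auto simp: W_def)
  qed
  obtain x1 where "x1 \<in> L1" "d < c \<bullet> x1" using ne(1) pos by blast
  then have W1: "W \<inter> L1 \<noteq> {}" using has_W[OF L1] by blast
  obtain x2 where "x2 \<in> L2" "d < c \<bullet> x2" using ne(2) pos by blast
  then obtain v2 where v2: "v2 \<in> W" "v2 \<in> L2" using has_W[OF L2] by blast
  then have v2': "v2 \<in> W - L1" using WF by blast
  define \<beta> where "\<beta> = Min (q ` (W \<inter> L1))"
  obtain w1 where w1: "w1 \<in> W" "w1 \<in> L1" "\<beta> = q w1"
    using Min_in[of "q ` (W \<inter> L1)"] finW W1 unfolding \<beta>_def by blast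
  have "0 < \<beta>" using q_pos w1 WF by auto
  define r where "r = Max ((\<lambda>w. (\<beta> - q w) / p w) ` (W - L1))"
  obtain w2 where w2: "w2 \<in> W" "w2 \<notin> L1" "r = (\<beta> - q w2) / p w2"
    using Max_in[of "(\<lambda>w. (\<beta> - q w) / p w) ` (W - L1)"] finW v2' unfolding r_def by blast
  have r_ge: "(\<beta> - q w) / p w \<le> r" if "w \<in> W" "w \<notin> L1" for w
    unfolding r_def using that finW by (intro Max_ge) auto
  \<comment> \<open>\<open>v2\<close> lies in \<open>L2\<close>, so its ratio is
    \<open>\<beta> / p v2\<close>, which is positive and bounds \<open>r\<close> from below.\<close>
  have "q v2 = 0" using v2 h2(2) by (simp add: q_def)
  then have "0 < r"
    using r_ge[of v2] v2' p_pos[of v2] \<open>0 < \<beta>\<close> by (smt (verit) DiffE divide_pos_pos)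
  define H where "H = h2 + r *\<^sub>R h1 + \<beta> *\<^sub>R c"
  define b where "b = b2 + r * b1 + \<beta> * d"
  have ex: "H \<bullet> x - b = (h2 \<bullet> x - b2) + r * (h1 \<bullet> x - b1) + \<beta> * (c \<bullet> x - d)" for x
    by (simp add: H_def b_def inner_add_left algebra_simps)
  define Q where "Q = P \<inter> {x. H \<bullet> x = b}"
  have Q: "x \<in> Q \<longleftrightarrow> x \<in> P \<and> (h2 \<bullet> x - b2) + r * (h1 \<bullet> x - b1) + \<beta> * (c \<bullet> x - d) = 0" for x
    using ex[of x] by (auto simp: Q_def)
  \<comment> \<open>Factoring out the positive height reduces the sign of the slack on
    \<open>W\<close> to that of \<open>\<beta> - q x - r * p x\<close>.\<close>
  have onW: "(h2 \<bullet> x - b2) + r * (h1 \<bullet> x - b1) + \<beta> * (c \<bullet> x - d)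
      = (\<beta> - q x - r * p x) * (c \<bullet> x - d)" if "x \<in> W" for x
    unfolding pW[OF that] qW[OF that] by (simp add: algebra_simps)
  have p0: "p x = 0" if "x \<in> L1" for x using that h1(2) by (simp add: p_def)
  have Q_face: "Q face_of P"
    unfolding Q_def
  proof (rule face_of_vertex_functional[OF P])
    fix v assume v: "v \<in> vertices P"
    have "H \<bullet> v - b \<le> 0"
    proof (cases "v \<in> W")
      case True
      have "\<beta> - q v - r * p v \<le> 0"
      proof (cases "v \<in> L1")
        case True
        then have "\<beta> \<le> q v" using \<open>v \<in> W\<close> finW by (simp add: \<beta>_def)
        then show ?thesis using p0 True by simp
      next
        case False
        then show ?thesis using r_ge[of v] p_pos[of v] \<open>v \<in> W\<close> by (simp add: field_simps)
      qed
      then show ?thesis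
        using W_pos[OF True] unfolding ex onW[OF True] by (simp add: mult_nonpos_nonneg)
    next
      case False
      then have "\<beta> * (c \<bullet> v - d) \<le> 0" using v \<open>0 < \<beta>\<close> by (simp add: W_def mult_nonneg_nonpos)
      moreover have "v \<in> P" using v vertices_subset by blast
      then have "h2 \<bullet> v - b2 \<le> 0" "r * (h1 \<bullet> v - b1) \<le> 0"
        using h1(1) h2(1) \<open>0 < r\<close> by (auto simp: mult_nonneg_nonpos)
      ultimately show ?thesis unfolding ex by linarith
    qed
    then show "H \<bullet> v \<le> b" by simp
  qed
  have FQ: "?F \<subseteq> Q" using h1(2) h2(2) zero by (auto simp: Q)
  \<comment> \<open>At a point not above level \<open>d\<close> all three summands are nonpositive;
    as they add up to 0, the first two vanish and the point lies in both faces.\<close>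
  have up: "d < c \<bullet> x" if "x \<in> Q" "x \<notin> ?F" for x
  proof (rule ccontr)
    assume "\<not> d < c \<bullet> x"
    then have "\<beta> * (c \<bullet> x - d) \<le> 0" using \<open>0 < \<beta>\<close> by (simp add: mult_nonneg_nonpos)
    moreover have xP: "x \<in> P" using that by (simp add: Q)
    moreover have "h2 \<bullet> x - b2 \<le> 0" "r * (h1 \<bullet> x - b1) \<le> 0"
      using xP h1(1) h2(1) \<open>0 < r\<close> by (auto simp: mult_nonneg_nonpos)
    moreover have "(h2 \<bullet> x - b2) + r * (h1 \<bullet> x - b1) + \<beta> * (c \<bullet> x - d) = 0"
      using that by (simp add: Q)
    ultimately have "h2 \<bullet> x - b2 = 0" "r * (h1 \<bullet> x - b1) = 0" by linarith+
    then show False using that xP h1(2) h2(2) \<open>0 < r\<close> by auto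
  qed
  have "w1 \<in> Q" using onW[OF w1(1)] p0[OF w1(2)] w1 WP by (simp add: Q)
  have "w2 \<in> Q" using onW[OF w2(1)] p_pos[of w2] w2 WP by (simp add: Q)
  \<comment> \<open>Two strict inclusions of faces give the two extra dimensions: \<open>w1\<close>
    separates \<open>Q \<inter> L1\<close> from \<open>L1 \<inter> L2\<close>, and \<open>w2\<close>
    separates \<open>Q\<close> from \<open>Q \<inter> L1\<close>.\<close>
  have QL: "(Q \<inter> L1) face_of P" using Q_face L1 by (rule face_of_Int)
  have "(Q \<inter> L1) face_of Q" using QL face_of_face[OF Q_face] by blast
  then have "aff_dim (Q \<inter> L1) < aff_dim Q"
    using \<open>w2 \<in> Q\<close> w2(2) by (intro face_of_aff_dim_lt face_of_imp_convex[OF Q_face]) auto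
  moreover have "?F face_of (Q \<inter> L1)"
    using face_of_face[OF QL] face_of_Int[OF L1 L2] FQ by blast
  then have "aff_dim ?F < aff_dim (Q \<inter> L1)"
    using \<open>w1 \<in> Q\<close> w1 WF by (intro face_of_aff_dim_lt face_of_imp_convex[OF QL]) blast+
  ultimately have "aff_dim ?F + 2 \<le> aff_dim Q" by linarith
  then show ?thesis using that Q_face FQ up by blast
qed

text \<open>If \<open>L1\<close> were contained in \<open>L2\<close>, it would be a face of equal
  dimension, hence all of \<open>L2\<close>. So the intersection is a proper face of
  \<open>L1\<close>; its dimension is then at most that of its face \<open>F\<close>, which forces
  equality.\<close>

lemma Int_faces_eq_common_facet:
  fixes P :: "'a::euclidean_space set"
  assumes L1: "L1 face_of P" and L2: "L2 face_of P" and F: "F face_of P" and "F \<subseteq> L1 \<inter> L2"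
    and dim: "aff_dim L1 = aff_dim F + 1" "aff_dim L2 = aff_dim F + 1" and "L1 \<noteq> L2"
  shows "L1 \<inter> L2 = F"
proof -
  have I: "(L1 \<inter> L2) face_of P" using L1 L2 by (rule face_of_Int)
  have "L1 \<inter> L2 \<noteq> L1"
  proof
    assume eq: "L1 \<inter> L2 = L1"
    then have "L1 face_of L2" using face_of_face[OF L2] L1 by blast
    then show False
      using face_of_aff_dim_lt[OF face_of_imp_convex[OF L2]] dim \<open>L1 \<noteq> L2\<close> by force
  qed
  then have "aff_dim (L1 \<inter> L2) < aff_dim L1"
    using face_of_face[OF L1] I by (intro face_of_aff_dim_lt face_of_imp_convex[OF L1]) auto
  moreover have "F face_of (L1 \<inter> L2)" using face_of_face[OF I] F assms(4) by blast
  ultimately show ?thesis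
    using face_of_aff_dim_lt[OF face_of_imp_convex[OF I], of F] dim by force
qed

section \<open>Facets and edges through a vertex\<close>

text \<open>A proper nonempty face is the intersection of the facets containing it, so one of these
  facets must miss part of \<open>G\<close>. That \<open>H\<close> is proper follows from
  \<open>G\<close>.\<close>

lemma facet_avoiding:
  fixes P :: "'a::euclidean_space set"
  assumes "polytope P" "H face_of P" "H \<noteq> {}" "\<not> G \<subseteq> H" "G \<subseteq> P"
  obtains Q where "Q facet_of P" "H \<subseteq> Q" "\<not> G \<subseteq> Q"
proof -
  have "H = \<Inter>{F. F facet_of P \<and> H \<subseteq> F}"
    using assms by (intro face_of_polyhedron) (auto simp: polytope_imp_polyhedron)
  then show ?thesis using assms(4) that by blast
qed

text \<open>Descends through facets containing \<open>v\<close> until dimension 1 is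
  reached.\<close>

lemma polytope_edge_at_vertex:
  fixes P :: "'a::euclidean_space set"
  assumes "polytope P" "v \<in> vertices P" "1 \<le> aff_dim P"
  shows "\<exists>E. E edge_of P \<and> v \<in> E"
  using assms
proof (induction "nat (aff_dim P)" arbitrary: P rule: less_induct)
  case less
  have vP: "v \<in> P" using less.prems(2) vertices_subset by blast
  show ?case
  proof (cases "aff_dim P = 1")
    case True
    moreover have "P face_of P"
      using less.prems(1) by (simp add: face_of_refl polytope_imp_convex)
    ultimately show ?thesis
      using vP by (auto simp: edge_of_def)
  next
    case False
    have "\<not> P \<subseteq> {v}" using less.prems(3) by (auto simp: subset_singleton_iff)
    then obtain Q where Q: "Q facet_of P" "{v} \<subseteq> Q"
      using facet_avoiding[of P "{v}" P] less.prems by (auto simp: singleton_face_of_vertex)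
    then have QP: "Q face_of P" and "aff_dim Q = aff_dim P - 1" by (auto simp: facet_of_def)
    then have "\<exists>E. E edge_of Q \<and> v \<in> E"
      using less.prems False Q(2) mem_vertices_face[OF QP] face_of_polytope_polytope
      by (intro less.hyps) auto
    then show ?thesis using QP unfolding edge_of_def by (meson face_of_trans)
  qed
qed

text \<open>After a first edge \<open>E1\<close>, a facet through \<open>v\<close> that does not
  contain \<open>E1\<close> supplies a second one.\<close>

lemma polytope_two_edges_at_vertex:
  fixes P :: "'a::euclidean_space set"
  assumes P: "polytope P" and v: "v \<in> vertices P" and "2 \<le> aff_dim P"
  obtains E1 E2 where "E1 edge_of P" "E2 edge_of P" "v \<in> E1" "v \<in> E2" "E1 \<noteq> E2"
proof -
  obtain E1 where E1: "E1 edge_of P" "v \<in> E1"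
    using polytope_edge_at_vertex[OF P v] assms(3) by auto
  then have "\<not> E1 \<subseteq> {v}" by (auto simp: edge_of_def subset_singleton_iff)
  then obtain Q where Q: "Q facet_of P" "v \<in> Q" "\<not> E1 \<subseteq> Q"
    using facet_avoiding[of P "{v}" E1] P v E1(1) by (auto simp: singleton_face_of_vertex edge_of_imp_subset)
  then have QP: "Q face_of P" and "aff_dim Q = aff_dim P - 1" by (auto simp: facet_of_def)
  then obtain E2 where E2: "E2 edge_of Q" "v \<in> E2"
    using polytope_edge_at_vertex[of Q v] face_of_polytope_polytope[OF P QP] assms(3) v Q(2)
      mem_vertices_face[OF QP] by auto
  have "E2 edge_of P" using E2(1) QP unfolding edge_of_def by (meson face_of_trans)
  moreover have "E1 \<noteq> E2" using E2(1) Q(3) edge_of_imp_subset by blast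
  ultimately show ?thesis using that E1 E2 by blast
qed

text \<open>A compact convex collinear set is a segment. This links edges as faces to the
  two-element sets that represent them in the canopy.\<close>

lemma edge_obtain_endpoints:
  fixes P :: "'a::euclidean_space set"
  assumes "polytope P" "E edge_of P"
  obtains u v where "u \<noteq> v" "E = closed_segment u v" "vertices E = {u, v}"
    "u \<in> vertices P" "v \<in> vertices P"
proof -
  have EP: "E face_of P" and dim: "aff_dim E = 1" using assms(2) by (auto simp: edge_of_def)
  have pE: "polytope E" using assms(1) EP by (rule face_of_polytope_polytope)
  have "E \<noteq> {}" "collinear E" using dim by (auto simp: collinear_aff_dim)
  then obtain u v where E: "E = closed_segment u v"
    using compact_convex_collinear_segment[of E] polytope_imp_compact[OF pE] polytope_imp_convex[OF pE]
    by auto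
  have "u \<noteq> v" using dim E by auto
  moreover have V: "vertices E = {u, v}"
    unfolding vertices_def E by (auto simp: extreme_point_of_segment)
  ultimately show ?thesis using that E mem_vertices_face[OF EP] by blast
qed

lemma edge_with_endpoint:
  fixes P :: "'a::euclidean_space set"
  assumes "polytope P" "E edge_of P" "v \<in> vertices P" "v \<in> E"
  obtains u where "u \<noteq> v" "E = closed_segment v u" "vertices E = {v, u}" "u \<in> vertices P"
proof -
  obtain x y where xy: "x \<noteq> y" "E = closed_segment x y" "vertices E = {x, y}"
    "x \<in> vertices P" "y \<in> vertices P" using edge_obtain_endpoints[OF assms(1,2)] by blast
  have "v \<in> vertices E" using assms mem_vertices_face by (auto simp: edge_of_def)
  then show ?thesis
    using xy that[of y] that[of x] by (auto simp: closed_segment_commute insert_commute)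
qed

section \<open>Treetopes\<close>

text \<open>Finitely many strict inequalities that hold in the limit at 0 hold together for some
  positive value. This fixes the size of the perturbation in the acyclicity proof.\<close>

lemma small_multiple_less:
  fixes f g :: "'b \<Rightarrow> real"
  assumes "finite X" "\<And>x. x \<in> X \<Longrightarrow> 0 < f x"
  obtains \<epsilon> where "0 < \<epsilon>" "\<And>x. x \<in> X \<Longrightarrow> \<epsilon> * g x < f x"
proof -
  have "eventually (\<lambda>e. e * g x < f x) (at_right 0)" if "x \<in> X" for x
  proof -
    have "((\<lambda>e. e * g x) \<longlongrightarrow> 0 * g x) (at_right 0)" by (intro tendsto_intros)
    then show ?thesis using assms(2)[OF that] by (intro order_tendstoD(2)) auto
  qed
  then have "eventually (\<lambda>e. \<forall>x\<in>X. e * g x < f x) (at_right 0)"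
    by (intro eventually_ball_finite assms(1)) auto
  then have "eventually (\<lambda>e. 0 < e \<and> (\<forall>x\<in>X. e * g x < f x)) (at_right (0::real))"
    using eventually_at_right_less[of 0] by eventually_elim auto
  then obtain e where "0 < e \<and> (\<forall>x\<in>X. e * g x < f x)"
    using eventually_happens'[OF trivial_limit_at_right_real] by blast
  then show ?thesis using that by blast
qed

lemma treetope_polytope: "treetope P B \<Longrightarrow> polytope P"
  by (simp add: treetope_def)

lemma treetope_base_face: "treetope P B \<Longrightarrow> B face_of P"
  by (simp add: treetope_def facet_of_imp_face_of)

text \<open>The sign of the exposing functional is reversed, so that \<open>c\<close> acts as a
  height whose minimum \<open>d\<close> is attained exactly on the base.\<close>

lemma treetope_base_functional:
  fixes P :: "'a::euclidean_space set"
  assumes "treetope P B"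
  obtains d c where "\<And>x. x \<in> P \<Longrightarrow> d \<le> c \<bullet> x" "\<And>x. x \<in> B \<longleftrightarrow> x \<in> P \<and> c \<bullet> x = d"
proof -
  obtain h b where hb: "\<And>x. x \<in> P \<Longrightarrow> h \<bullet> x \<le> b" "\<And>x. x \<in> B \<longleftrightarrow> x \<in> P \<and> h \<bullet> x = b"
    using face_obtain_functional[OF treetope_polytope treetope_base_face] assms by blast
  show ?thesis
    using hb by (intro that[of "- b" "- h"]) auto
qed

lemma treetope_point_above_base:
  fixes P :: "'a::euclidean_space set"
  assumes "treetope P B"
  obtains x where "x \<in> P" "x \<notin> B"
proof -
  have "B \<noteq> P" "B \<subseteq> P" using assms by (auto simp: treetope_def facet_of_imp_subset)
  then show ?thesis using that by blast
qed

text \<open>If a counterexample meets the base in \<open>G\<close>, then one of its facets contains a facet of \<open>G\<close>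
  but not \<open>G\<close> itself, and is a counterexample one dimension lower.\<close>
lemma treetope_dim_bound:
  fixes P :: "'a::euclidean_space set"
  assumes "treetope P B" "F face_of P" "F \<inter> B \<noteq> {}"
  shows "aff_dim F \<le> aff_dim (F \<inter> B) + 1"
  using assms(2,3)
proof (induction "nat (aff_dim (F \<inter> B))" arbitrary: F rule: less_induct)
  case less
  let ?G = "F \<inter> B"
  have PF: "polytope F"
    using less.prems(1) treetope_polytope[OF assms(1)] face_of_polytope_polytope by blast
  have GP: "?G face_of P" using less.prems(1) treetope_base_face[OF assms(1)] by (rule face_of_Int)
  then have GF: "?G face_of F" using face_of_face[OF less.prems(1)] by blast
  then have PG: "polytope ?G" using PF face_of_polytope_polytope by blast
  show ?case
  proof (cases "0 < aff_dim ?G")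
    case False
    moreover have "0 \<le> aff_dim ?G" using less.prems(2) by (simp flip: not_less add: aff_dim_negative_iff)
    ultimately have 0: "aff_dim ?G = 0" by simp
    then obtain x where "?G = {x}" by (auto simp: aff_dim_eq_0)
    then show ?thesis using assms(1) less.prems(1) 0 unfolding treetope_def by auto
  next
    case True
    obtain H where H: "H facet_of ?G" using polytope_facet_exists[OF PG True] by blast
    then have HG: "H face_of ?G" "H \<noteq> {}" and dimH: "aff_dim H = aff_dim ?G - 1"
      by (auto simp: facet_of_def)
    have HF: "H face_of F" using HG(1) GF by (rule face_of_trans)
    have "\<not> ?G \<subseteq> H" using dimH face_of_imp_subset[OF HG(1)] by (metis diff_add_cancel dual_order.antisym zless_add1_eq less_irrefl)
    then obtain Q where Q: "Q facet_of F" "H \<subseteq> Q" "\<not> ?G \<subseteq> Q"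
      using facet_avoiding[OF PF HF HG(2), of ?G] by blast
    have QF: "Q face_of F" and dimQ: "aff_dim Q = aff_dim F - 1"
      using Q(1) by (auto simp: facet_of_def)
    have QP: "Q face_of P" using QF less.prems(1) by (rule face_of_trans)
    have "(Q \<inter> B) face_of ?G"
      using face_of_Int[OF QP treetope_base_face[OF assms(1)]] face_of_face[OF GP]
        face_of_imp_subset[OF QF] by blast
    moreover have "Q \<inter> B \<noteq> ?G" using Q(3) by blast
    ultimately have lt: "aff_dim (Q \<inter> B) < aff_dim ?G"
      using face_of_aff_dim_lt[OF face_of_imp_convex[OF GP]] by blast
    \<comment> \<open>Facets are nonempty by definition, so \<open>H\<close> keeps \<open>Q\<close>
      in contact with the base.\<close>
    have "Q \<inter> B \<noteq> {}" using Q(2) HG face_of_imp_subset[OF HG(1)] by blast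
    then have "aff_dim Q \<le> aff_dim (Q \<inter> B) + 1"
      using QP lt True by (intro less.hyps) auto
    \<comment> \<open>\<open>F\<close> loses exactly one dimension in passing to \<open>Q\<close>,
      while the intersection with \<open>B\<close> loses at least one.\<close>
    then show ?thesis using lt dimQ by linarith
  qed
qed

section \<open>Existence and uniqueness of lifts\<close>

text \<open>The dimension is automatic: \<open>treetope_dim_bound\<close> bounds it above, and
  \<open>F\<close> being a proper face of \<open>F'\<close> bounds it below.\<close>

lemma is_lift_iff:
  fixes P :: "'a::euclidean_space set"
  assumes T: "treetope P B" and F: "F \<noteq> {}"
  shows "is_lift P B F F' \<longleftrightarrow> F' face_of P \<and> F' \<inter> B = F \<and> F' \<noteq> F"
proof
  assume F': "F' face_of P \<and> F' \<inter> B = F \<and> F' \<noteq> F"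
  then have "aff_dim F' \<le> aff_dim F + 1" using treetope_dim_bound[OF T, of F'] F by auto
  moreover have "F face_of F'"
    using F' face_of_Int[of F' P B] face_of_face[of F' P F] treetope_base_face[OF T] by auto
  then have "aff_dim F < aff_dim F'"
    using F' by (intro face_of_aff_dim_lt) (auto simp: face_of_imp_convex)
  ultimately show "is_lift P B F F'" using F' by (simp add: is_lift_def)
qed (auto simp: is_lift_def)

text \<open>Tilting at \<open>F\<close> along the height gives a face whose points off
  \<open>F\<close> lie strictly above the base, so it meets \<open>B\<close> in \<open>F\<close>
  only.\<close>

lemma treetope_lift_exists:
  fixes P :: "'a::euclidean_space set"
  assumes T: "treetope P B" and F: "F face_of B" "F \<noteq> {}"
  shows "\<exists>F'. is_lift P B F F'"
proof -
  note B = treetope_base_face[OF T]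
  obtain d c where c: "\<And>x. x \<in> P \<Longrightarrow> d \<le> c \<bullet> x" "\<And>x. x \<in> B \<longleftrightarrow> x \<in> P \<and> c \<bullet> x = d"
    using treetope_base_functional[OF T] by metis
  obtain w where w: "w \<in> P" "w \<notin> B" using treetope_point_above_base[OF T] .
  have FP: "F face_of P" and FB: "F \<subseteq> B"
    using F B face_of_trans face_of_imp_subset by blast+
  have zero: "c \<bullet> x = d" if "x \<in> F" for x using that FB c by blast
  have "d < c \<bullet> w" using c w by (metis less_le)
  then obtain Q where Q: "Q face_of P" "F \<subseteq> Q" "Q \<noteq> F"
    "\<And>x. x \<in> Q \<Longrightarrow> x \<notin> F \<Longrightarrow> d < c \<bullet> x"
    using tilt_face[OF treetope_polytope[OF T] FP zero w(1)] by blast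
  then have "Q \<inter> B = F" using FB c(2) by force
  with Q show ?thesis using is_lift_iff[OF T F(2)] by blast
qed

text \<open>Two lifts would meet exactly in \<open>F\<close> and rise from it, so they would span a
  face that still meets \<open>B\<close> in \<open>F\<close> but violates
  \<open>treetope_dim_bound\<close>.\<close>

lemma treetope_lift_unique:
  fixes P :: "'a::euclidean_space set"
  assumes T: "treetope P B" and F: "F face_of B" "F \<noteq> {}"
    and L: "is_lift P B F L1" "is_lift P B F L2"
  shows "L1 = L2"
proof (rule ccontr)
  assume ne: "L1 \<noteq> L2"
  note B = treetope_base_face[OF T]
  obtain d c where c: "\<And>x. x \<in> P \<Longrightarrow> d \<le> c \<bullet> x" "\<And>x. x \<in> B \<longleftrightarrow> x \<in> P \<and> c \<bullet> x = d"
    using treetope_base_functional[OF T] by metis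
  have FP: "F face_of P" and FB: "F \<subseteq> B"
    using F B face_of_trans face_of_imp_subset by blast+
  have L1: "L1 face_of P" "aff_dim L1 = aff_dim F + 1" "L1 \<noteq> F" "L1 \<inter> B = F"
    and L2: "L2 face_of P" "aff_dim L2 = aff_dim F + 1" "L2 \<noteq> F" "L2 \<inter> B = F"
    using L by (auto simp: is_lift_def)
  have I: "L1 \<inter> L2 = F"
    using L1 L2 FP ne by (intro Int_faces_eq_common_facet[of L1 P L2 F]) auto
  have zero: "c \<bullet> x = d" if "x \<in> L1 \<inter> L2" for x using that FB c I by blast
  have pos: "d < c \<bullet> x" if "x \<in> L1 \<union> L2" "x \<notin> L1 \<inter> L2" for x
  proof -
    have "x \<in> P" "x \<notin> B"
      using that I L1(4) L2(4) face_of_imp_subset[OF L1(1)] face_of_imp_subset[OF L2(1)] by blast+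
    then show ?thesis using c by (metis less_le)
  qed
  obtain Q where Q: "Q face_of P" "L1 \<inter> L2 \<subseteq> Q"
    "\<And>x. x \<in> Q \<Longrightarrow> x \<notin> L1 \<inter> L2 \<Longrightarrow> d < c \<bullet> x" "aff_dim (L1 \<inter> L2) + 2 \<le> aff_dim Q"
    using two_upward_faces_span[OF treetope_polytope[OF T] L1(1) L2(1) _ _ zero pos] I L1(3) L2(3)
    by metis
  have "Q \<inter> B = F" using Q FB I c(2) by force
  then show False using treetope_dim_bound[OF T Q(1)] Q(4) I F(2) by simp
qed

lemma treetope_lift:
  fixes P :: "'a::euclidean_space set"
  assumes "treetope P B" "F face_of B" "F \<noteq> {}"
  shows "is_lift P B F (lift P B F)"
  unfolding lift_def
  using treetope_lift_exists[OF assms] treetope_lift_unique[OF assms] by (metis theI')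

text \<open>A face of \<open>L\<close> is a face of \<open>P\<close>, and it meets \<open>F\<close>
  in the same set as \<open>B\<close>; the defining condition is inherited.\<close>

lemma treetope_of_lift:
  fixes P :: "'a::euclidean_space set"
  assumes T: "treetope P B" and L: "is_lift P B F L" and "F face_of B" "F \<noteq> {}"
  shows "treetope L F"
  unfolding treetope_def
proof (intro conjI allI impI)
  have LP: "L face_of P" and LB: "L \<inter> B = F" using L by (auto simp: is_lift_def)
  show "polytope L" using treetope_polytope[OF T] LP by (rule face_of_polytope_polytope)
  have "F face_of P" using assms(3) treetope_base_face[OF T] by (rule face_of_trans)
  then have "F face_of L" using face_of_face[OF LP] LB by blast
  then show "F facet_of L" using L \<open>F \<noteq> {}\<close> by (simp add: facet_of_def is_lift_def)
  fix G assume G: "G face_of L \<and> (G \<inter> F = {} \<or> (\<exists>x. G \<inter> F = {x}))"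
  then have "G face_of P" "G \<subseteq> L" using face_of_face[OF LP] by auto
  moreover have "G \<inter> B = G \<inter> F" using \<open>G \<subseteq> L\<close> LB by blast
  ultimately show "aff_dim G \<le> 1" using T G unfolding treetope_def by auto
qed

section \<open>The canopy is a tree\<close>

lemma canopy_edgeD:
  fixes P :: "'a::euclidean_space set"
  assumes "polytope P" "{u, v} \<in> canopy_edges P B"
  shows "closed_segment u v edge_of P" "\<not> closed_segment u v \<subseteq> B" "u \<noteq> v"
    "u \<in> vertices P" "v \<in> vertices P"
proof -
  obtain E where E: "{u, v} = vertices E" "E edge_of P" "\<not> E \<subseteq> B"
    using assms(2) unfolding canopy_edges_def by blast
  obtain a b where ab: "a \<noteq> b" "E = closed_segment a b" "vertices E = {a, b}"
    "a \<in> vertices P" "b \<in> vertices P"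
    using edge_obtain_endpoints[OF assms(1) E(2)] .
  have "u = a \<and> v = b \<or> u = b \<and> v = a" using E(1) ab(3) by (simp add: doubleton_eq_iff)
  then show "closed_segment u v edge_of P" "\<not> closed_segment u v \<subseteq> B" "u \<noteq> v"
    "u \<in> vertices P" "v \<in> vertices P"
    using E ab by (auto simp: closed_segment_commute)
qed

lemma canopy_simple_graph:
  fixes P :: "'a::euclidean_space set"
  assumes "polytope P"
  shows "simple_graph (canopy_vertices P) (canopy_edges P B)"
  unfolding simple_graph_def canopy_vertices_def
proof (intro conjI ballI finite_vertices[OF assms])
  fix e assume "e \<in> canopy_edges P B"
  then obtain E where E: "e = vertices E" "E edge_of P" unfolding canopy_edges_def by blast
  obtain a b where "a \<noteq> b" "vertices E = {a, b}" "a \<in> vertices P" "b \<in> vertices P"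
    using edge_obtain_endpoints[OF assms E(2)] .
  then show "\<exists>u v. e = {u, v} \<and> u \<noteq> v \<and> u \<in> vertices P \<and> v \<in> vertices P"
    using E(1) by blast
qed

text \<open>Tilting at \<open>v\<close> gives a face whose other points are all higher than
  \<open>v\<close>. It meets the base at most in \<open>v\<close>, so the treetope condition makes
  it an edge.\<close>

lemma canopy_ascending_edge:
  fixes P :: "'a::euclidean_space set"
  assumes T: "treetope P B"
    and c: "\<And>x. x \<in> P \<Longrightarrow> d \<le> c \<bullet> x" "\<And>x. x \<in> B \<longleftrightarrow> x \<in> P \<and> c \<bullet> x = d"
    and v: "v \<in> vertices P" and x: "x \<in> P" "c \<bullet> v < c \<bullet> x"
  obtains u where "u \<in> vertices P" "{v, u} \<in> canopy_edges P B" "c \<bullet> v < c \<bullet> u"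
proof -
  note P = treetope_polytope[OF T]
  have vP: "v \<in> P" using v vertices_subset by blast
  have vf: "{v} face_of P" using v by (simp add: singleton_face_of_vertex)
  obtain Q where Q: "Q face_of P" "{v} \<subseteq> Q" "Q \<noteq> {v}"
    "\<And>y. y \<in> Q \<Longrightarrow> y \<notin> {v} \<Longrightarrow> c \<bullet> v < c \<bullet> y"
    using tilt_face[OF P vf, of c "c \<bullet> v" x] x by auto
  have "Q \<inter> B \<subseteq> {v}" using Q(4) c vP by force
  then have "aff_dim Q \<le> 1" using T Q(1) unfolding treetope_def by (metis subset_singletonD)
  moreover have "{v} face_of Q" using face_of_face[OF Q(1)] vf Q(2) by blast
  then have "aff_dim {v} < aff_dim Q"
    using Q(3) by (intro face_of_aff_dim_lt face_of_imp_convex[OF Q(1)]) auto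
  ultimately have E: "Q edge_of P" using Q(1) by (simp add: edge_of_def)
  then obtain u where u: "u \<noteq> v" "Q = closed_segment v u" "vertices Q = {v, u}" "u \<in> vertices P"
    using edge_with_endpoint[OF P E v] Q(2) by blast
  have up: "c \<bullet> v < c \<bullet> u" using Q(4)[of u] u(1,2) by simp
  then have "u \<notin> B" using c(1)[OF vP] c(2) by force
  then have "\<not> Q \<subseteq> B" using u(2) by auto
  then have "{v, u} \<in> canopy_edges P B" using E u(3) unfolding canopy_edges_def by blast
  with u(4) up show ?thesis using that by blast
qed

text \<open>Ascending edges lead from every vertex to the top level, by induction on the number of
  strictly higher vertices. The face at the top level misses the base, so it is at most an edge and
  joins any second top vertex to \<open>m\<close>.\<close>

lemma canopy_connected:
  fixes P :: "'a::euclidean_space set"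
  assumes T: "treetope P B"
  shows "graph_connected (canopy_vertices P) (canopy_edges P B)"
proof -
  note P = treetope_polytope[OF T]
  let ?E = "canopy_edges P B"
  obtain d c where c: "\<And>x. x \<in> P \<Longrightarrow> d \<le> c \<bullet> x" "\<And>x. x \<in> B \<longleftrightarrow> x \<in> P \<and> c \<bullet> x = d"
    using treetope_base_functional[OF T] by metis
  obtain x0 where x0: "x0 \<in> P" "x0 \<notin> B" using treetope_point_above_base[OF T] .
  have V: "finite (vertices P)" "vertices P \<noteq> {}"
    using finite_vertices[OF P] exists_vertex[OF P] x0 by blast+
  obtain m where m: "m \<in> vertices P" "\<And>v. v \<in> vertices P \<Longrightarrow> c \<bullet> v \<le> c \<bullet> m"
  proof -
    have "Max ((\<lambda>v. c \<bullet> v) ` vertices P) \<in> (\<lambda>v. c \<bullet> v) ` vertices P"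
      using V by (intro Max_in) auto
    then obtain m where "m \<in> vertices P" "c \<bullet> m = Max ((\<lambda>v. c \<bullet> v) ` vertices P)" by auto
    then show ?thesis using that[of m] V(1) by simp
  qed
  have m_top: "c \<bullet> x \<le> c \<bullet> m" if "x \<in> P" for x
    using inner_le_if_vertices[OF P m(2) that] .
  have reach: "(v, m) \<in> (graph_adj ?E)\<^sup>*" if "v \<in> vertices P" for v
    using that
  proof (induction "card {u \<in> vertices P. c \<bullet> v < c \<bullet> u}" arbitrary: v rule: less_induct)
    case less
    have vP: "v \<in> P" using less.prems vertices_subset by blast
    consider "c \<bullet> v < c \<bullet> m" | "v = m" | "c \<bullet> v = c \<bullet> m" "v \<noteq> m" using m(2)[OF less.prems] by linarith
    then show ?case
    proof cases
      case 1
      moreover have "m \<in> P" using m(1) vertices_subset by blast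
      ultimately obtain u where u: "u \<in> vertices P" "{v, u} \<in> ?E" "c \<bullet> v < c \<bullet> u"
        using canopy_ascending_edge[OF T c less.prems] by blast
      have "{w \<in> vertices P. c \<bullet> u < c \<bullet> w} \<subset> {w \<in> vertices P. c \<bullet> v < c \<bullet> w}"
        using u by auto
      then have "(u, m) \<in> (graph_adj ?E)\<^sup>*"
        using V(1) u(1) by (intro less.hyps psubset_card_mono) auto
      moreover have "(v, u) \<in> graph_adj ?E" using u by (auto simp: graph_adj_def)
      ultimately show ?thesis by (rule converse_rtrancl_into_rtrancl[rotated])
    next
      case 3
      let ?M = "P \<inter> {x. c \<bullet> x = c \<bullet> m}"
      have M: "?M face_of P" using face_of_vertex_functional[OF P m(2)] .
      have "d \<le> c \<bullet> x0" "c \<bullet> x0 \<noteq> d" using c x0 by auto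
      then have "c \<bullet> m \<noteq> d" using m_top[OF x0(1)] by linarith
      then have MB: "?M \<inter> B = {}" unfolding disjoint_iff using c(2) by simp
      then have "aff_dim ?M \<le> 1" using T M unfolding treetope_def by blast
      moreover have mv: "v \<in> ?M" "m \<in> ?M" using 3 vP m(1) vertices_subset by auto
      have "\<not> aff_dim ?M \<le> 0"
        using mv 3(2) aff_dim_subset[of "{v, m}" ?M] by (auto simp: aff_dim_2)
      ultimately have E: "?M edge_of P" using M by (simp add: edge_of_def)
      obtain u where u: "vertices ?M = {v, u}"
        by (rule edge_with_endpoint[OF P E less.prems mv(1)])
      have "m \<in> vertices ?M" using mem_vertices_face[OF M] m(1) mv by blast
      then have "vertices ?M = {v, m}" using u 3(2) by auto
      moreover have "\<not> ?M \<subseteq> B" using MB mv by blast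
      ultimately have "{v, m} \<in> ?E" using E unfolding canopy_edges_def by blast
      then have "(v, m) \<in> graph_adj ?E" using 3(2) by (auto simp: graph_adj_def)
      then show ?thesis by blast
    qed simp
  qed
  then show ?thesis
    using V(2) graph_adj_rtrancl_sym unfolding graph_connected_def canopy_vertices_def
    by (meson rtrancl_trans)
qed

text \<open>An edge leaving the base at \<open>w\<close> is a lift of \<open>{w}\<close>, and lifts
  are unique.\<close>

lemma canopy_edges_not_two_at_base_vertex:
  fixes P :: "'a::euclidean_space set"
  assumes T: "treetope P B" and "w \<in> B"
    and e: "{w, u1} \<in> canopy_edges P B" "{w, u2} \<in> canopy_edges P B"
  shows "u1 = u2"
proof -
  note P = treetope_polytope[OF T] and B = treetope_base_face[OF T]
  have w: "w \<in> vertices P" using canopy_edgeD[OF P e(1)] by blast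
  then have wB: "{w} face_of B"
    using mem_vertices_face[OF B] \<open>w \<in> B\<close> singleton_face_of_vertex by blast
  have lift: "is_lift P B {w} (closed_segment w u)" if "{w, u} \<in> canopy_edges P B" for u
  proof -
    note e = canopy_edgeD[OF P that]
    have E: "closed_segment w u face_of P" "aff_dim (closed_segment w u) = 1"
      using e(1) by (auto simp: edge_of_def)
    have I: "(closed_segment w u \<inter> B) face_of P" using E(1) B by (rule face_of_Int)
    \<comment> \<open>The intersection is a proper face of a segment and contains \<open>w\<close>,
      so it is \<open>{w}\<close>.\<close>
    then have "(closed_segment w u \<inter> B) face_of (closed_segment w u)"
      using face_of_face[OF E(1)] by blast
    then have "aff_dim (closed_segment w u \<inter> B) < 1"
      using face_of_aff_dim_lt[of "closed_segment w u" "closed_segment w u \<inter> B"] E(2) e(2) by auto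
    moreover have "w \<in> closed_segment w u \<inter> B" using \<open>w \<in> B\<close> by simp
    then have "0 \<le> aff_dim (closed_segment w u \<inter> B)" by (metis aff_dim_negative_iff emptyE not_less)
    ultimately have "aff_dim (closed_segment w u \<inter> B) = 0" by linarith
    then obtain y where "closed_segment w u \<inter> B = {y}" by (auto simp: aff_dim_eq_0)
    then have "closed_segment w u \<inter> B = {w}" using \<open>w \<in> closed_segment w u \<inter> B\<close> by auto
    moreover have "closed_segment w u \<noteq> {w}" using e(3) by (metis ends_in_segment(2) singletonD)
    ultimately show ?thesis using is_lift_iff[OF T, of "{w}"] E(1) by auto
  qed
  have "closed_segment w u1 = closed_segment w u2"
    using treetope_lift_unique[OF T wB] lift e by blast
  then show ?thesis by (metis canopy_edgeD(3)[OF P e(1)] closed_segment_eq doubleton_eq_iff)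
qed

text \<open>Here \<open>c\<close> may be any functional that puts \<open>w\<close> strictly above
  all vertices of the base; this leaves room for a perturbed height. The face spanned by two
  ascending edges would miss the base and have dimension at least 2.\<close>

lemma canopy_no_two_ascending_edges:
  fixes P :: "'a::euclidean_space set"
  assumes T: "treetope P B"
    and base: "\<And>b. b \<in> vertices B \<Longrightarrow> c \<bullet> b < c \<bullet> w"
    and e: "{w, u1} \<in> canopy_edges P B" "{w, u2} \<in> canopy_edges P B"
    and up: "c \<bullet> w < c \<bullet> u1" "c \<bullet> w < c \<bullet> u2"
  shows "u1 = u2"
proof (rule ccontr)
  assume "u1 \<noteq> u2"
  note P = treetope_polytope[OF T] and B = treetope_base_face[OF T]
  let ?L1 = "closed_segment w u1" and ?L2 = "closed_segment w u2"
  note e1 = canopy_edgeD[OF P e(1)] and e2 = canopy_edgeD[OF P e(2)]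
  have L: "?L1 face_of P" "?L2 face_of P" "aff_dim ?L1 = 1" "aff_dim ?L2 = 1"
    using e1(1) e2(1) by (auto simp: edge_of_def)
  have wf: "{w} face_of P" using e1(4) by (simp add: singleton_face_of_vertex)
  have "?L1 \<noteq> ?L2" using \<open>u1 \<noteq> u2\<close> e1(3) by (metis closed_segment_eq doubleton_eq_iff)
  then have I: "?L1 \<inter> ?L2 = {w}"
    using L wf by (intro Int_faces_eq_common_facet[of ?L1 P ?L2 "{w}"]) auto
  have asc: "c \<bullet> w < c \<bullet> x" if "x \<in> closed_segment w u" "x \<noteq> w" "c \<bullet> w < c \<bullet> u" for x u
  proof -
    have "x \<in> {(1 - t) *\<^sub>R w + t *\<^sub>R u | t. 0 \<le> t \<and> t \<le> 1}"
      using that(1) by (simp only: closed_segment_def)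
    then obtain t where t: "0 \<le> t" "x = (1 - t) *\<^sub>R w + t *\<^sub>R u" by blast
    have "t \<noteq> 0"
    proof
      assume "t = 0"
      then show False using that(2) t(2) by simp
    qed
    moreover have "c \<bullet> x - c \<bullet> w = t * (c \<bullet> u - c \<bullet> w)"
      unfolding t(2) by (simp add: inner_add_right algebra_simps)
    ultimately show ?thesis
      using t(1) that(3) mult_pos_pos[of t "c \<bullet> u - c \<bullet> w"] by linarith
  qed
  have ne: "?L1 \<noteq> ?L1 \<inter> ?L2" "?L2 \<noteq> ?L1 \<inter> ?L2"
    using e1(3) e2(3) unfolding I by (metis ends_in_segment(2) singletonD)+
  have zero: "c \<bullet> x = c \<bullet> w" if "x \<in> ?L1 \<inter> ?L2" for x using that I by auto
  have pos: "c \<bullet> w < c \<bullet> x" if "x \<in> ?L1 \<union> ?L2" "x \<notin> ?L1 \<inter> ?L2" for x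
    using that asc up unfolding I by auto
  obtain Q where Q: "Q face_of P" "?L1 \<inter> ?L2 \<subseteq> Q"
    "\<And>x. x \<in> Q \<Longrightarrow> x \<notin> ?L1 \<inter> ?L2 \<Longrightarrow> c \<bullet> w < c \<bullet> x"
    "aff_dim (?L1 \<inter> ?L2) + 2 \<le> aff_dim Q"
    using two_upward_faces_span[OF P L(1,2) ne zero pos] by blast
  \<comment> \<open>The intersection is a face, so if nonempty it has a vertex; that vertex belongs
    to \<open>B\<close>, hence is lower than \<open>w\<close>, whereas \<open>Q\<close> has no point
    below \<open>w\<close>.\<close>
  have "Q \<inter> B = {}"
  proof (rule ccontr)
    assume ne: "Q \<inter> B \<noteq> {}"
    have QB: "(Q \<inter> B) face_of P" using Q(1) B by (rule face_of_Int)
    obtain b where "b \<in> vertices (Q \<inter> B)"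
      using exists_vertex[OF face_of_polytope_polytope[OF P QB] ne] .
    then have b: "b \<in> Q" "b \<in> vertices B"
      using mem_vertices_face[OF QB] mem_vertices_face[OF B] by auto
    then have "c \<bullet> b < c \<bullet> w" by (intro base)
    moreover from this have "b \<noteq> w" by auto
    ultimately show False using Q(3)[of b] b(1) I by auto
  qed
  then have "aff_dim Q \<le> 1" using T Q(1) unfolding treetope_def by blast
  then show False using Q(4) I by simp
qed

text \<open>Among the lowest vertices of a cycle, the one of largest norm is the strictly lowest vertex
  for a small perturbation of the height functional, so two edges of the cycle ascend from it.\<close>
lemma canopy_acyclic:
  fixes P :: "'a::euclidean_space set"
  assumes T: "treetope P B"
  shows "\<not> graph_has_cycle (canopy_vertices P) (canopy_edges P B)"
proof
  assume "graph_has_cycle (canopy_vertices P) (canopy_edges P B)"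
  then obtain cs where cs: "length cs \<ge> 3" "distinct cs" "set cs \<subseteq> vertices P"
    "\<forall>i < length cs. {cs ! i, cs ! ((i + 1) mod length cs)} \<in> canopy_edges P B"
    unfolding graph_has_cycle_def canopy_vertices_def by blast
  note P = treetope_polytope[OF T] and B = treetope_base_face[OF T]
  note nbrs = cycle_two_neighbours[OF cs(1,2,4)]
  define S where "S = set cs"
  have S: "finite S" "S \<noteq> {}" "S \<subseteq> vertices P" using cs(1,3) by (auto simp: S_def)
  \<comment> \<open>A cycle has two distinct edges at each of its vertices, which is impossible at a
    vertex of the base.\<close>
  have SB: "x \<notin> B" if "x \<in> S" for x
    using nbrs[of x] canopy_edges_not_two_at_base_vertex[OF T] that unfolding S_def by metis
  obtain d c where c: "\<And>x. x \<in> P \<Longrightarrow> d \<le> c \<bullet> x" "\<And>x. x \<in> B \<longleftrightarrow> x \<in> P \<and> c \<bullet> x = d"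
    using treetope_base_functional[OF T] by metis
  define \<mu> where "\<mu> = Min ((\<lambda>x. c \<bullet> x) ` S)"
  define S0 where "S0 = {x \<in> S. c \<bullet> x = \<mu>}"
  have "\<mu> \<in> (\<lambda>x. c \<bullet> x) ` S" unfolding \<mu>_def using S by (intro Min_in) auto
  then have S0: "finite S0" "S0 \<noteq> {}" using S(1) by (auto simp: S0_def)
  have \<mu>_le: "\<mu> \<le> c \<bullet> x" if "x \<in> S" for x unfolding \<mu>_def using that S by simp
  obtain w where w: "w \<in> S0" "\<And>x. x \<in> S0 \<Longrightarrow> norm x \<le> norm w"
  proof -
    have "Max (norm ` S0) \<in> norm ` S0" using S0 by (intro Max_in) auto
    then obtain w where "w \<in> S0" "norm w = Max (norm ` S0)" by auto
    then show ?thesis using that[of w] S0(1) by simp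
  qed
  have wS: "w \<in> S" and cw: "c \<bullet> w = \<mu>" using w(1) by (auto simp: S0_def)
  \<comment> \<open>Expanding the square of \<open>w - x\<close> and using that \<open>x\<close> is
    no longer than \<open>w\<close>.\<close>
  have wx: "w \<bullet> x < w \<bullet> w" if "x \<in> S0" "x \<noteq> w" for x
  proof -
    have "0 < (w - x) \<bullet> (w - x)" using that(2) by simp
    moreover have "x \<bullet> x \<le> w \<bullet> w"
      using w(2)[OF that(1)] by (simp add: norm_le)
    ultimately show ?thesis by (simp add: inner_diff_left inner_diff_right inner_commute)
  qed
  have "w \<in> P" using wS S(3) vertices_subset by blast
  then have dw: "d < c \<bullet> w" using c SB[OF wS] by (metis less_le)
  \<comment> \<open>The points whose strict comparison with \<open>w\<close> must survive the
    perturbation: the higher vertices of the cycle and the vertices of the base.\<close>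
  let ?X = "(S - S0) \<union> vertices B"
  have PB: "polytope B" using P B by (rule face_of_polytope_polytope)
  have "finite ?X" using S(1) finite_vertices[OF PB] by simp
  moreover have "0 < \<bar>c \<bullet> x - c \<bullet> w\<bar>" if "x \<in> ?X" for x
    using that cw dw c(2) vertices_subset[of B] by (auto simp: S0_def)
  ultimately obtain \<epsilon> where \<epsilon>: "0 < \<epsilon>"
    "\<And>x. x \<in> ?X \<Longrightarrow> \<epsilon> * \<bar>w \<bullet> x - w \<bullet> w\<bar> < \<bar>c \<bullet> x - c \<bullet> w\<bar>"
    using small_multiple_less[of ?X "\<lambda>x. \<bar>c \<bullet> x - c \<bullet> w\<bar>" "\<lambda>x. \<bar>w \<bullet> x - w \<bullet> w\<bar>"] by blast
  \<comment> \<open>Subtracting a multiple of \<open>w\<close> lowers \<open>w\<close> more than any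
    other point of \<open>S0\<close>, which breaks the tie at the lowest level.\<close>
  define k where "k = c - \<epsilon> *\<^sub>R w"
  have k: "k \<bullet> x - k \<bullet> w = (c \<bullet> x - c \<bullet> w) - \<epsilon> * (w \<bullet> x - w \<bullet> w)" for x
    by (simp add: k_def inner_diff_left algebra_simps)
  have \<epsilon>': "\<bar>\<epsilon> * (w \<bullet> x - w \<bullet> w)\<bar> < \<bar>c \<bullet> x - c \<bullet> w\<bar>" if "x \<in> ?X" for x
    using \<epsilon>(2)[OF that] \<epsilon>(1) by (simp add: abs_mult)
  have up: "k \<bullet> w < k \<bullet> x" if "x \<in> S" "x \<noteq> w" for x
  proof (cases "x \<in> S0")
    case True
    then have "\<epsilon> * (w \<bullet> x - w \<bullet> w) < 0" using wx[OF True that(2)] \<epsilon>(1) by (simp add: mult_pos_neg)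
    moreover have "c \<bullet> x = c \<bullet> w" using True cw by (simp add: S0_def)
    ultimately show ?thesis using k[of x] by linarith
  next
    case False
    then show ?thesis using \<epsilon>'[of x] k[of x] \<mu>_le[OF that(1)] cw that(1) by auto
  qed
  have down: "k \<bullet> b < k \<bullet> w" if "b \<in> vertices B" for b
  proof -
    have "c \<bullet> b = d" using that c(2) vertices_subset by blast
    then show ?thesis using \<epsilon>'[of b] k[of b] dw that by auto
  qed
  obtain u1 u2 where u: "u1 \<in> S" "u2 \<in> S" "u1 \<noteq> u2" "u1 \<noteq> w" "u2 \<noteq> w"
    "{w, u1} \<in> canopy_edges P B" "{w, u2} \<in> canopy_edges P B"
    using nbrs[of w] wS unfolding S_def by metis
  then show False
    using canopy_no_two_ascending_edges[OF T down u(6,7)] up by blast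
qed

lemma canopy_is_tree:
  fixes P :: "'a::euclidean_space set"
  assumes "treetope P B"
  shows "is_tree (canopy_vertices P) (canopy_edges P B)"
  using canopy_simple_graph[OF treetope_polytope] canopy_connected canopy_acyclic assms
  unfolding is_tree_def by blast

section \<open>Canopies of lifts, and the partition of the faces\<close>

text \<open>An instance of \<open>minimal_subtreeI\<close>. The bound on the dimension of
  \<open>F\<close> enters twice: \<open>F\<close> has two distinct vertices, and \<open>L\<close>
  has dimension at least 2, so two edges of \<open>L\<close> meet at each of its vertices.\<close>

lemma canopy_of_lift_minimal:
  fixes P :: "'a::euclidean_space set"
  assumes T: "treetope P B" and L: "is_lift P B F L" and F: "F face_of B" "1 \<le> aff_dim F"
  shows "is_minimal_subtree_containing (canopy_vertices P) (canopy_edges P B) (vertices F)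
    (canopy_vertices L) (canopy_edges L F)"
proof -
  have "F \<noteq> {}" using F(2) by auto
  have LP: "L face_of P" and LB: "L \<inter> B = F" and dimL: "aff_dim L = aff_dim F + 1"
    using L by (auto simp: is_lift_def)
  have TL: "treetope L F" using treetope_of_lift[OF T L F(1) \<open>F \<noteq> {}\<close>] .
  note PL = treetope_polytope[OF TL] and FL = treetope_base_face[OF TL]
  have sub: "is_subtree (canopy_vertices P) (canopy_edges P B) (canopy_vertices L) (canopy_edges L F)"
    unfolding is_subtree_def
  proof (intro conjI canopy_is_tree[OF TL])
    show "canopy_vertices L \<subseteq> canopy_vertices P"
      using mem_vertices_face[OF LP] by (auto simp: canopy_vertices_def)
    show "canopy_edges L F \<subseteq> canopy_edges P B"
    proof
      fix e assume "e \<in> canopy_edges L F"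
      then obtain E where E: "e = vertices E" "E face_of L" "aff_dim E = 1" "\<not> E \<subseteq> F"
        unfolding canopy_edges_def edge_of_def by blast
      then have "E edge_of P" "\<not> E \<subseteq> B"
        using face_of_face[OF LP] LB by (auto simp: edge_of_def)
      then show "e \<in> canopy_edges P B" using E(1) unfolding canopy_edges_def by blast
    qed
  qed
  obtain E where "E edge_of F"
    using polytope_edge_at_vertex exists_vertex F(2) face_of_polytope_polytope[OF PL FL] \<open>F \<noteq> {}\<close>
    by metis
  then obtain a b where ab: "a \<noteq> b" "a \<in> vertices F" "b \<in> vertices F"
    using edge_obtain_endpoints face_of_polytope_polytope[OF PL FL] by metis
  have VF: "vertices F \<subseteq> canopy_vertices L"
    using mem_vertices_face[OF FL] by (auto simp: canopy_vertices_def)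
  show ?thesis
  proof (rule minimal_subtreeI[OF canopy_is_tree[OF T] sub VF])
    show "a \<in> canopy_vertices L" "b \<in> canopy_vertices L" "a \<noteq> b" using ab VF by auto
    fix x y assume "x \<in> canopy_vertices L" "x \<notin> vertices F"
    then have x: "x \<in> vertices L" "x \<notin> F"
      using mem_vertices_face[OF FL] by (auto simp: canopy_vertices_def)
    have nbr: "\<exists>z. vertices E = {x, z} \<and> {x, z} \<in> canopy_edges L F \<and> E = closed_segment x z"
      if E: "E edge_of L" "x \<in> E" for E
    proof -
      obtain z where "E = closed_segment x z" "vertices E = {x, z}"
        using edge_with_endpoint[OF PL E(1) x(1) E(2)] .
      moreover have "\<not> E \<subseteq> F" using x(2) E(2) by blast
      ultimately show ?thesis using E(1) unfolding canopy_edges_def by blast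
    qed
    obtain E1 E2 where E: "E1 edge_of L" "E2 edge_of L" "x \<in> E1" "x \<in> E2" "E1 \<noteq> E2"
      using polytope_two_edges_at_vertex[OF PL x(1)] dimL F(2) by auto
    \<comment> \<open>Distinct edges at \<open>x\<close> have distinct other ends, so one of these
      ends differs from any given \<open>y\<close>.\<close>
    obtain z1 z2 where "{x, z1} \<in> canopy_edges L F" "{x, z2} \<in> canopy_edges L F" "z1 \<noteq> z2"
      using nbr[OF E(1,3)] nbr[OF E(2,4)] E(5) by metis
    then show "\<exists>z. z \<noteq> y \<and> {x, z} \<in> canopy_edges L F" by metis
  qed
qed

theorem mainTheorem6:
  fixes P B :: "'a::euclidean_space set"
  assumes "treetope P B"
  shows "is_tree (canopy_vertices P) (canopy_edges P B)
    \<and> (\<forall>F. F face_of B \<and> F \<noteq> {} \<longrightarrow> (\<exists>!F'. is_lift P B F F'))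
    \<and> {F. F face_of P \<and> F \<noteq> {}} =
        {F. F face_of B \<and> F \<noteq> {}}
        \<union> {F. F face_of P \<and> F \<noteq> {} \<and> F \<inter> B = {} \<and> aff_dim F \<le> 1}
        \<union> {F'. \<exists>F. F face_of B \<and> F \<noteq> {} \<and> is_lift P B F F'}
    \<and> {F. F face_of B \<and> F \<noteq> {}} \<inter> {F. F face_of P \<and> F \<noteq> {} \<and> F \<inter> B = {} \<and> aff_dim F \<le> 1} = {}
    \<and> {F. F face_of B \<and> F \<noteq> {}} \<inter> {F'. \<exists>F. F face_of B \<and> F \<noteq> {} \<and> is_lift P B F F'} = {}
    \<and> {F. F face_of P \<and> F \<noteq> {} \<and> F \<inter> B = {} \<and> aff_dim F \<le> 1}
        \<inter> {F'. \<exists>F. F face_of B \<and> F \<noteq> {} \<and> is_lift P B F F'} = {}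
    \<and> (\<forall>F. F face_of B \<and> aff_dim F \<ge> 1 \<longrightarrow>
          treetope (lift P B F) F
        \<and> is_minimal_subtree_containing (canopy_vertices P) (canopy_edges P B) (vertices F)
            (canopy_vertices (lift P B F)) (canopy_edges (lift P B F) F))"
proof (intro conjI)
  note T = assms and B = treetope_base_face[OF assms]
  have sub: "F \<subseteq> B" if "F face_of B" for F using that by (rule face_of_imp_subset)
  show "is_tree (canopy_vertices P) (canopy_edges P B)" using canopy_is_tree[OF T] .
  show "\<forall>F. F face_of B \<and> F \<noteq> {} \<longrightarrow> (\<exists>!F'. is_lift P B F F')"
    using treetope_lift_exists[OF T] treetope_lift_unique[OF T] by blast
  show "{F. F face_of P \<and> F \<noteq> {}} =
        {F. F face_of B \<and> F \<noteq> {}}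
        \<union> {F. F face_of P \<and> F \<noteq> {} \<and> F \<inter> B = {} \<and> aff_dim F \<le> 1}
        \<union> {F'. \<exists>F. F face_of B \<and> F \<noteq> {} \<and> is_lift P B F F'}" (is "?all = ?base \<union> ?off \<union> ?lifts")
  proof (intro subset_antisym subsetI)
    fix F assume "F \<in> ?all"
    then have F: "F face_of P" "F \<noteq> {}" by auto
    \<comment> \<open>These cases produce, in order, the base faces, the faces off the base and the
      lifts.\<close>
    consider "F \<subseteq> B" | "F \<inter> B = {}" | "F \<inter> B \<noteq> {}" "F \<inter> B \<noteq> F" by blast
    then show "F \<in> ?base \<union> ?off \<union> ?lifts"
    proof cases
      case 1
      then show ?thesis using F face_of_face[OF B] by blast
    next
      case 2
      then show ?thesis using F T unfolding treetope_def by blast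
    next
      case 3
      have "(F \<inter> B) face_of B" using face_of_face[OF B] face_of_Int[OF F(1) B] by blast
      moreover have "is_lift P B (F \<inter> B) F" using is_lift_iff[OF T 3(1)] F(1) 3(2) by auto
      ultimately show ?thesis using 3(1) by blast
    qed
  next
    fix F assume "F \<in> ?base \<union> ?off \<union> ?lifts"
    then show "F \<in> ?all" using face_of_face[OF B] by (auto simp: is_lift_def)
  qed
  show "{F. F face_of B \<and> F \<noteq> {}} \<inter> {F. F face_of P \<and> F \<noteq> {} \<and> F \<inter> B = {} \<and> aff_dim F \<le> 1} = {}"
    using sub by blast
  \<comment> \<open>A lift contained in \<open>B\<close> would equal its own intersection with
    \<open>B\<close>, that is, the face it lifts.\<close>
  show "{F. F face_of B \<and> F \<noteq> {}} \<inter> {F'. \<exists>F. F face_of B \<and> F \<noteq> {} \<and> is_lift P B F F'} = {}"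
    using sub unfolding is_lift_def by blast
  show "{F. F face_of P \<and> F \<noteq> {} \<and> F \<inter> B = {} \<and> aff_dim F \<le> 1}
        \<inter> {F'. \<exists>F. F face_of B \<and> F \<noteq> {} \<and> is_lift P B F F'} = {}"
    unfolding is_lift_def by blast
  show "\<forall>F. F face_of B \<and> aff_dim F \<ge> 1 \<longrightarrow>
          treetope (lift P B F) F
        \<and> is_minimal_subtree_containing (canopy_vertices P) (canopy_edges P B) (vertices F)
            (canopy_vertices (lift P B F)) (canopy_edges (lift P B F) F)"
  proof (intro allI impI)
    fix F assume F: "F face_of B \<and> aff_dim F \<ge> 1"
    then have "F \<noteq> {}" by auto
    then have "is_lift P B F (lift P B F)" using treetope_lift[OF T] F by blast
    then show "treetope (lift P B F) F
        \<and> is_minimal_subtree_containing (canopy_vertices P) (canopy_edges P B) (vertices F)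
            (canopy_vertices (lift P B F)) (canopy_edges (lift P B F) F)"
      using treetope_of_lift[OF T] canopy_of_lift_minimal[OF T] F \<open>F \<noteq> {}\<close> by blast
  qed
qed

end
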